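(* Let $k\ge1$ be an integer. For any finite nonempty set $X\subseteq[0,1]^k$, there exists a Hamiltonian cycle $H$ on $X$ such that both of the following hold: (a) for any integer $t\ge1$, $$S_k(H)=\sum_{e\in H}|e|^k\le 2(2t+1)\cdot\left(1+\frac1t\right)^{k/2}\cdot k^{k/2};$$ (b) $S_k(H)\le 2\mathrm{e}(k+1)\cdot k^{k/2}$, where $\mathrm{e}=2.718\ldots$ is Euler's number. In particular, $S_k^{\mathrm{HC}}\le 2\mathrm{e}(k+1)\cdot k^{k/2}$.
   Context: $|\cdot|$ is the Euclidean norm on $\mathbb{R}^k$; for an edge $e=\mathbf{a}\mathbf{b}$, $|e|:=|\mathbf{a}-\mathbf{b}|$. A Hamiltonian cycle $H$ on a finite nonempty set $X$ with $|X|=n$ is a Hamiltonian cycle in the complete graph on $X$, i.e. a closed tour given by an ordering $\mathbf{x}_1,\dots,\mathbf{x}_n$ of $X$ with edges $\mathbf{x}_i\mathbf{x}_{i+1}$, $1\le i\le n$, $\mathbf{x}_{n+1}=\mathbf{x}_1$. Edges are counted with multiplicity: for $n=2$ the cycle consists of the same edge taken twice; for $n=1$ it is a single degenerate edge of length $0$. $S_k(H):=\sum_{e\in H}|e|^k$. Set $S_k^{\mathrm{HC}}(X):=\min_H S_k(H)$ over all Hamiltonian cycles $H$ on $X$, and $S_k^{\mathrm{HC}}:=\sup\{S_k^{\mathrm{HC}}(X): X\subseteq[0,1]^k \text{ finite}\}$. *)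

theory Defs
  imports "HOL-Analysis.Analysis"
begin

text \<open>
  A Hamiltonian cycle on \<open>X\<close> is represented by an ordering of \<open>X\<close>, read cyclically.  Different
  orderings may describe the same cycle, which affects neither existence statements nor minima.
\<close>
definition hamiltonian_cycle :: "'a set \<Rightarrow> 'a list \<Rightarrow> bool" where
  "hamiltonian_cycle X H \<longleftrightarrow> distinct H \<and> set H = X"

text \<open>
  The sum runs over the \<open>n\<close> positions of the ordering, so edges count with multiplicity: for
  \<open>n = 2\<close> the edge occurs twice, for \<open>n = 1\<close> there is one degenerate edge of length \<open>0\<close>.
\<close>
definition S :: "nat \<Rightarrow> 'a::real_normed_vector list \<Rightarrow> real" where
  "S k H = (\<Sum>i<length H. norm (H ! i - H ! (Suc i mod length H)) ^ k)"

definition S_HC :: "nat \<Rightarrow> 'a::real_normed_vector set \<Rightarrow> real" where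
  "S_HC k X = Min (S k ` {H. hamiltonian_cycle X H})"

lemma finite_hamiltonian_cycles: "finite {H. hamiltonian_cycle X H}"
proof (cases "finite X")
  case True
  have "{H. hamiltonian_cycle X H} \<subseteq> {H. set H \<subseteq> X \<and> length H = card X}"
    by (auto simp: hamiltonian_cycle_def distinct_card)
  then show ?thesis
    using finite_lists_length_eq[OF True] finite_subset by blast
next
  case False
  then have "{H. hamiltonian_cycle X H} = {}"
    by (auto simp: hamiltonian_cycle_def)
  then show ?thesis by simp
qed

lemma hamiltonian_cycles_nonempty: "finite X \<Longrightarrow> {H. hamiltonian_cycle X H} \<noteq> {}"
  using finite_distinct_list by (auto simp: hamiltonian_cycle_def)

text \<open>
  The supremum over all finite nonempty subsets of the unit cube in dimension \<open>k = CARD('n)\<close>.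
  It is taken in the extended reals, so that its finiteness is not presupposed: an unbounded
  family would give \<open>\<infinity>\<close>.
\<close>
definition S_HC_sup :: "'n::finite itself \<Rightarrow> ereal" where
  "S_HC_sup _ =
     (SUP X \<in> {X :: (real ^ 'n) set. finite X \<and> X \<noteq> {} \<and> X \<subseteq> cbox 0 1}.
        ereal (S_HC CARD('n) X))"

end

(*
  Take a Hamiltonian cycle minimising the sum of squared edge lengths (for every k). Exchanging two
  edges a b and c d for a c and b d cannot decrease that sum. Hence, by Blichfeldt's averaging
  argument, no point is in more than 2 t + 1 of the open balls of radius
  (|e| / 2) sqrt (t / (t + 1)) about the midpoints of the edges e. The unit cube lies in a ball of
  radius sqrt k / 2, and at least half the volume of each ball about an edge midpoint lies in
  it, since it contains both ends of the edge. Comparing volumes gives (a), and (b) is the case t = ceiling (k / 2).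
*)
theory Submission imports Defs begin

section \<open>Edge sums along lists and the exchange inequality for minimal tours\<close>

fun path_sum :: "('a \<Rightarrow> 'a \<Rightarrow> real) \<Rightarrow> 'a list \<Rightarrow> real" where
  "path_sum f (x # y # zs) = f x y + path_sum f (y # zs)"
| "path_sum f _ = 0"

lemma path_sum_conv_sum: "path_sum f xs = (\<Sum>i<length xs - 1. f (xs ! i) (xs ! Suc i))"
  by (induction f xs rule: path_sum.induct) (simp_all add: sum.lessThan_Suc_shift del: sum.lessThan_Suc)

lemma path_sum_append:
  assumes "xs \<noteq> []" "ys \<noteq> []"
  shows "path_sum f (xs @ ys) = path_sum f xs + f (last xs) (hd ys) + path_sum f ys"
  using assms
proof (induction f xs rule: path_sum.induct)
  case ("2_2" f x)
  then show ?case by (cases ys) auto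
qed auto

lemma path_sum_rev:
  assumes "\<And>x y. f x y = f y x"
  shows "path_sum f (rev xs) = path_sum f xs"
proof (induction xs rule: induct_list012)
  case (3 x y zs)
  have "path_sum f (rev (x # y # zs)) = path_sum f (rev (y # zs) @ [x])"
    by simp
  also have "\<dots> = path_sum f (rev (y # zs)) + f y x"
    by (subst path_sum_append) (simp_all add: last_rev)
  finally show ?case using 3 assms by simp
qed auto

text \<open>Repeating the first vertex at the end opens the cycle into a path, which can then be cut
  at any append without modular indices.\<close>

lemma S_eq_path_sum:
  assumes "H \<noteq> []"
  shows "S k H = path_sum (\<lambda>x y. norm (x - y) ^ k) (H @ [hd H])"
  unfolding S_def path_sum_conv_sum
proof (rule sum.cong)
  fix i assume i: "i \<in> {..<length (H @ [hd H]) - 1}"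
  have "H ! (Suc i mod length H) = (H @ [hd H]) ! Suc i"
  proof (cases "Suc i = length H")
    case True
    then show ?thesis using assms by (simp add: nth_append hd_conv_nth)
  next
    case False
    then show ?thesis using i by (simp add: nth_append)
  qed
  then show "norm (H ! i - H ! (Suc i mod length H)) ^ k =
      norm ((H @ [hd H]) ! i - (H @ [hd H]) ! Suc i) ^ k"
    using i by (simp add: nth_append)
qed simp

text \<open>Reversing the segment \<open>B\<close> keeps every edge inside \<open>A\<close>,
  \<open>B\<close> and \<open>C\<close> and replaces only the two edges at the ends of
  \<open>B\<close>, so minimality compares just these two pairs.\<close>

lemma two_opt_append:
  assumes min: "\<And>H'. hamiltonian_cycle X H' \<Longrightarrow> S k (A @ B @ C) \<le> S k H'"
    and H: "hamiltonian_cycle X (A @ B @ C)" and ne: "A \<noteq> []" "B \<noteq> []"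
  shows "norm (last A - hd B) ^ k + norm (last B - hd (C @ A)) ^ k
       \<le> norm (last A - last B) ^ k + norm (hd B - hd (C @ A)) ^ k"
proof -
  define f :: "'a \<Rightarrow> 'a \<Rightarrow> real" where "f x y = norm (x - y) ^ k" for x y
  \<comment> \<open>\<open>D\<close> stands for both \<open>B\<close> and \<open>rev B\<close>. The
    vertex after \<open>D\<close> is \<open>hd (C @ A)\<close>, which also covers an empty
    \<open>C\<close>, where the tour closes up at once.\<close>
  have cyc: "S k (A @ D @ C) = path_sum f A + f (last A) (hd D) + path_sum f D
      + f (last D) (hd (C @ A)) + path_sum f (C @ [hd A])" if "D \<noteq> []" for D
  proof -
    have "S k (A @ D @ C) = path_sum f (A @ D @ (C @ [hd A]))"
      using ne that by (simp add: S_eq_path_sum f_def [abs_def])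
    then show ?thesis using ne that by (cases C) (simp_all add: path_sum_append)
  qed
  have "hamiltonian_cycle X (A @ rev B @ C)"
    using H by (auto simp: hamiltonian_cycle_def)
  from min [OF this] have "S k (A @ B @ C) \<le> S k (A @ rev B @ C)" .
  moreover have "path_sum f (rev B) = path_sum f B"
    by (rule path_sum_rev) (simp add: f_def norm_minus_commute)
  ultimately show ?thesis
    using ne by (simp add: cyc hd_rev last_rev f_def)
qed

text \<open>The segment to reverse consists of the positions \<open>i + 1\<close> to
  \<open>j\<close>. If \<open>j\<close> is the last position, \<open>C\<close> is empty and the
  successor of \<open>j\<close> wraps around to the head of \<open>A\<close>.\<close>

lemma two_opt:
  assumes min: "\<And>H'. hamiltonian_cycle X H' \<Longrightarrow> S k H \<le> S k H'"
    and H: "hamiltonian_cycle X H" and ij: "i < j" "j < length H"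
  shows "norm (H ! i - H ! (Suc i mod length H)) ^ k + norm (H ! j - H ! (Suc j mod length H)) ^ k
       \<le> norm (H ! i - H ! j) ^ k
         + norm (H ! (Suc i mod length H) - H ! (Suc j mod length H)) ^ k"
proof -
  define A B C where "A = take (Suc i) H" and "B = drop (Suc i) (take (Suc j) H)"
    and "C = drop (Suc j) H"
  have "A @ B = take (Suc j) H"
    unfolding A_def B_def using ij
    by (metis Suc_leI append_take_drop_id min.absorb1 order.strict_implies_order take_take not_less_eq)
  then have HABC: "H = A @ B @ C"
    unfolding C_def by (metis append.assoc append_take_drop_id)
  have ne: "A \<noteq> []" "B \<noteq> []"
    using ij by (auto simp: A_def B_def)
  have "last A = H ! i"
    using ij by (simp add: A_def take_Suc_conv_app_nth)
  moreover have "hd B = H ! (Suc i mod length H)"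
    using ij by (simp add: B_def hd_drop_conv_nth)
  moreover have "last B = H ! j"
    using ij by (simp add: B_def take_Suc_conv_app_nth)
  moreover have "hd (C @ A) = H ! (Suc j mod length H)"
  proof (cases "Suc j = length H")
    case True
    then show ?thesis using ij by (cases H) (auto simp: C_def A_def)
  next
    case False
    then show ?thesis using ij by (simp add: C_def hd_append hd_drop_conv_nth)
  qed
  ultimately show ?thesis
    using two_opt_append [of X k A B C] min H ne unfolding HABC [symmetric] by simp
qed

section \<open>Blichfeldt averaging: how many midpoint balls can share a point\<close>

text \<open>Expanding the squares, the two sides differ by twice the squared norm of the sum of all
  \<open>u i\<close>.\<close>

lemma sum_sum_norm_diff_squared_le:
  fixes u :: "'i \<Rightarrow> 'a::real_inner"
  shows "(\<Sum>i\<in>I. \<Sum>j\<in>I. (norm (u i - u j))\<^sup>2) \<le> 2 * real (card I) * (\<Sum>i\<in>I. (norm (u i))\<^sup>2)"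
proof -
  have "(\<Sum>i\<in>I. \<Sum>j\<in>I. (norm (u i - u j))\<^sup>2)
      = (\<Sum>i\<in>I. \<Sum>j\<in>I. (norm (u i))\<^sup>2 + (norm (u j))\<^sup>2 - 2 * (u i \<bullet> u j))"
    by (simp add: power2_norm_eq_inner inner_diff inner_commute algebra_simps)
  also have "\<dots> = 2 * real (card I) * (\<Sum>i\<in>I. (norm (u i))\<^sup>2)
      - 2 * ((\<Sum>i\<in>I. u i) \<bullet> (\<Sum>j\<in>I. u j))"
    by (simp add: sum.distrib sum_subtractf inner_sum_left inner_sum_right inner_commute
        sum_distrib_left sum_distrib_right algebra_simps)
  finally show ?thesis by simp
qed

text \<open>Blichfeldt's averaging: sum the pairwise exchange inequality over all pairs.\<close>
lemma card_balls_at_midpoints_le: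
  fixes a b :: "'i \<Rightarrow> 'a::real_inner" and t :: real
  assumes "finite I" and "t > 0"
    and exch: "\<And>i j. i \<in> I \<Longrightarrow> j \<in> I \<Longrightarrow> i \<noteq> j \<Longrightarrow>
      (norm (a i - b i))\<^sup>2 + (norm (a j - b j))\<^sup>2 \<le> (norm (a i - a j))\<^sup>2 + (norm (b i - b j))\<^sup>2"
    and ball: "\<And>i. i \<in> I \<Longrightarrow> y \<in> ball (midpoint (a i) (b i)) (sqrt (t / (t + 1)) * norm (a i - b i) / 2)"
  shows "card I < 2 * (t + 1)"
proof (cases "I = {}")
  case False
  define \<tau> where "\<tau> = t / (t + 1)"
  define m e where "m = real (card I)" and "e i = (norm (a i - b i))\<^sup>2" for i
  define E where "E = (\<Sum>i\<in>I. e i)"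
  \<comment> \<open>Lying in an open ball forces a positive radius, hence a nondegenerate edge. For
    \<open>close\<close>, the squared distances from \<open>y\<close> to the two ends add up to
    twice the squared distance to the midpoint plus \<open>e i / 2\<close>.\<close>
  have pos: "0 < e i" and close: "(norm (a i - y))\<^sup>2 + (norm (b i - y))\<^sup>2 < (1 + \<tau>) / 2 * e i"
    if "i \<in> I" for i
  proof -
    define r where "r = sqrt (\<tau>) * norm (a i - b i) / 2"
    have d: "dist (midpoint (a i) (b i)) y < r"
      using ball [OF that] by (simp add: r_def \<tau>_def)
    then have "0 < r" by (metis zero_le_dist order.strict_trans1)
    then show "0 < e i" by (auto simp: r_def e_def)
    have "(dist (midpoint (a i) (b i)) y)\<^sup>2 < r\<^sup>2"
      using d by (intro power_strict_mono) auto
    also have "r\<^sup>2 = \<tau> * e i / 4"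
      using \<open>t > 0\<close> by (simp add: r_def e_def \<tau>_def power_mult_distrib power_divide)
    finally have "(dist (midpoint (a i) (b i)) y)\<^sup>2 < \<tau> * e i / 4" .
    moreover have "(norm (a i - y))\<^sup>2 + (norm (b i - y))\<^sup>2 = 2 * (dist (midpoint (a i) (b i)) y)\<^sup>2 + e i / 2"
      by (simp add: e_def dist_norm midpoint_def power2_norm_eq_inner inner_diff inner_add
          inner_commute field_simps)
    ultimately show "(norm (a i - y))\<^sup>2 + (norm (b i - y))\<^sup>2 < (1 + \<tau>) / 2 * e i"
      by (simp add: algebra_simps)
  qed
  have "0 < E" unfolding E_def using assms(1) False pos by (intro sum_pos) auto
  have "m > 0" unfolding m_def using assms(1) False by (simp add: card_gt_0_iff)
  \<comment> \<open>The exchange inequality is available only for distinct indices. The correction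
    term makes the diagonal summands zero, which costs \<open>2 * E\<close> in total.\<close>
  have "2 * m * E - 2 * E = (\<Sum>i\<in>I. \<Sum>j\<in>I. e i + e j - (if i = j then 2 * e i else 0))"
  proof -
    have "(\<Sum>i\<in>I. \<Sum>j\<in>I. e i + e j - (if i = j then 2 * e i else 0))
        = (\<Sum>i\<in>I. m * e i + E - 2 * e i)"
      using assms(1) by (intro sum.cong) (simp_all add: sum.distrib sum_subtractf E_def m_def)
    then show ?thesis
      by (simp add: sum.distrib sum_subtractf sum_distrib_left [symmetric] m_def flip: E_def)
  qed
  also have "\<dots> \<le> (\<Sum>i\<in>I. \<Sum>j\<in>I. (norm (a i - a j))\<^sup>2 + (norm (b i - b j))\<^sup>2)"
    using exch by (intro sum_mono) (auto simp: e_def)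
  \<comment> \<open>Taking \<open>y\<close> as origin leaves differences unchanged and brings in the
    distances to \<open>y\<close> that \<open>close\<close> controls.\<close>
  also have "\<dots> = (\<Sum>i\<in>I. \<Sum>j\<in>I. (norm ((a i - y) - (a j - y)))\<^sup>2)
      + (\<Sum>i\<in>I. \<Sum>j\<in>I. (norm ((b i - y) - (b j - y)))\<^sup>2)"
    by (simp add: sum.distrib)
  also have "\<dots> \<le> 2 * m * (\<Sum>i\<in>I. (norm (a i - y))\<^sup>2) + 2 * m * (\<Sum>i\<in>I. (norm (b i - y))\<^sup>2)"
    unfolding m_def by (intro add_mono sum_sum_norm_diff_squared_le)
  also have "\<dots> = 2 * m * (\<Sum>i\<in>I. (norm (a i - y))\<^sup>2 + (norm (b i - y))\<^sup>2)"
    by (simp add: sum.distrib algebra_simps)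
  also have "\<dots> < 2 * m * ((1 + \<tau>) / 2 * E)"
    unfolding E_def sum_distrib_left [of "(1 + \<tau>) / 2"] using assms(1) False \<open>m > 0\<close>
    by (intro mult_strict_left_mono sum_strict_mono close) auto
  finally have "(2 * m - 2) * E < m * (1 + \<tau>) * E"
    by (simp add: algebra_simps)
  \<comment> \<open>This says \<open>m * (1 - \<tau>) < 2\<close>, and
    \<open>1 - \<tau> = 1 / (t + 1)\<close>.\<close>
  then have "2 * m - 2 < m * (1 + \<tau>)"
    using \<open>0 < E\<close> by simp
  then show ?thesis
    using \<open>t > 0\<close> by (simp add: m_def \<tau>_def field_simps)
qed (use \<open>t > 0\<close> in simp)

section \<open>Volume estimates\<close>

text \<open>
  Of two points of the small ball that are symmetric about its centre, at least one lies in the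
  large ball.
\<close>
lemma measure_ball_le_twice_inter_cball:
  fixes p c :: "'a::euclidean_space"
  assumes "(dist c p)\<^sup>2 + r\<^sup>2 \<le> R\<^sup>2" "0 \<le> R"
  shows "measure lebesgue (ball p r) \<le> 2 * measure lebesgue (ball p r \<inter> cball c R)"
proof -
  define A where "A = ball p r \<inter> cball c R"
  \<comment> \<open>The reflection of \<open>A\<close> in \<open>p\<close>, written as an affine map
    to make its volume available; \<open>A\<close> and \<open>B\<close> will cover the ball.\<close>
  define B where "B = (\<lambda>y. (-1) *\<^sub>R y + 2 *\<^sub>R p) ` A"
  have A: "A \<in> lmeasurable" unfolding A_def by (intro fmeasurable.Int) auto
  have mB: "measure lebesgue B = measure lebesgue A"
    unfolding B_def by (subst measure_lebesgue_affine) simp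
  have "B = ball p r \<inter> cball (2 *\<^sub>R p - c) R"
  proof (rule set_eqI)
    fix y
    have "y \<in> B \<longleftrightarrow> 2 *\<^sub>R p - y \<in> A"
      by (auto simp: B_def intro!: image_eqI [of _ _ "2 *\<^sub>R p - y"])
    moreover have "dist p (2 *\<^sub>R p - y) = dist p y"
      by (simp add: dist_norm scaleR_2 norm_minus_commute)
    moreover have "dist c (2 *\<^sub>R p - y) = dist (2 *\<^sub>R p - c) y"
      by (simp add: dist_norm norm_minus_commute algebra_simps)
    ultimately show "y \<in> B \<longleftrightarrow> y \<in> ball p r \<inter> cball (2 *\<^sub>R p - c) R"
      by (simp add: A_def)
  qed
  then have B: "B \<in> lmeasurable" by (auto intro: fmeasurable.Int)
  have "ball p r \<subseteq> A \<union> B"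
  proof
    fix y assume y: "y \<in> ball p r"
    define z where "z = 2 *\<^sub>R p - y"
    have zp: "z \<in> ball p r" using y by (simp add: z_def dist_norm scaleR_2 norm_minus_commute)
    \<comment> \<open>Parallelogram law, with \<open>p\<close> the midpoint of \<open>y\<close> and
      \<open>z\<close>. The sum is at most \<open>2 * R^2\<close>, so one of the two points is
      within \<open>R\<close> of \<open>c\<close>.\<close>
    have "(dist c y)\<^sup>2 + (dist c z)\<^sup>2 = 2 * (dist c p)\<^sup>2 + 2 * (dist p y)\<^sup>2"
      by (simp add: z_def dist_norm power2_norm_eq_inner inner_diff inner_commute algebra_simps)
    moreover have "(dist p y)\<^sup>2 \<le> r\<^sup>2" using y by (intro power_mono) auto
    ultimately have "(dist c y)\<^sup>2 \<le> R\<^sup>2 \<or> (dist c z)\<^sup>2 \<le> R\<^sup>2" using assms(1) by linarith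
    then have "dist c y \<le> R \<or> dist c z \<le> R" using assms(2) power2_le_imp_le by blast
    then show "y \<in> A \<union> B"
    proof
      assume "dist c z \<le> R"
      then have "z \<in> A" using zp by (simp add: A_def)
      moreover have "y = (-1) *\<^sub>R z + 2 *\<^sub>R p" by (simp add: z_def)
      ultimately show ?thesis unfolding B_def by blast
    qed (use y in \<open>simp add: A_def\<close>)
  qed
  then have "measure lebesgue (ball p r) \<le> measure lebesgue (A \<union> B)"
    using A B by (intro measure_mono_fmeasurable) auto
  also have "\<dots> \<le> measure lebesgue A + measure lebesgue B"
    using A B by (intro measure_Un_le) auto
  finally show ?thesis by (simp add: mB A_def)
qed

text \<open>Integrate the multiplicity function, the sum of the indicators: it is at most
  \<open>c\<close> on \<open>B\<close> and vanishes outside.\<close>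

lemma sum_measure_le_multiplicity:
  assumes "finite I" "B \<in> fmeasurable M"
    and A: "\<And>i. i \<in> I \<Longrightarrow> A i \<in> fmeasurable M" "\<And>i. i \<in> I \<Longrightarrow> A i \<subseteq> B"
    and mult: "\<And>y. y \<in> B \<Longrightarrow> real (card {i \<in> I. y \<in> A i}) \<le> c"
  shows "(\<Sum>i\<in>I. measure M (A i)) \<le> c * measure M B"
proof -
  have "(\<Sum>i\<in>I. measure M (A i)) = (\<Sum>i\<in>I. \<integral>y. indicator (A i) y \<partial>M)"
    using A sets.Int_space_eq2 fmeasurableD by (intro sum.cong) (auto simp: )
  also have "\<dots> = (\<integral>y. (\<Sum>i\<in>I. indicator (A i) y) \<partial>M)"
    using A by (subst Bochner_Integration.integral_sum) (auto simp: fmeasurable_def)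
  also have "\<dots> \<le> (\<integral>y. c * indicator B y \<partial>M)"
  proof (rule integral_mono)
    show "integrable M (\<lambda>y. \<Sum>i\<in>I. indicator (A i) y :: real)"
      using A by (intro Bochner_Integration.integrable_sum) (auto simp: fmeasurable_def)
    show "integrable M (\<lambda>y. c * indicator B y)"
      using assms(2) by (auto simp: fmeasurable_def)
    fix y
    have eq: "(\<Sum>i\<in>I. indicator (A i) y :: real) = real (card {i \<in> I. y \<in> A i})"
      using sum.inter_filter [OF assms(1), of "\<lambda>_. 1 :: real" "\<lambda>i. y \<in> A i"]
      by (simp add: indicator_def of_bool_def)
    show "(\<Sum>i\<in>I. indicator (A i) y) \<le> c * indicator B y"
    proof (cases "y \<in> B")
      case False
      then have "{i \<in> I. y \<in> A i} = {}" using A(2) by auto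
      with False show ?thesis
        by (simp add: eq)
    qed (simp add: eq mult)
  qed
  also have "\<dots> = c * measure M B"
    using assms(2) sets.Int_space_eq2 [of B M] by (simp add: fmeasurableD)
  finally show ?thesis .
qed

section \<open>The bound for tours minimising the sum of squares\<close>

text \<open>Minimality concerns squares while the bound concerns the power \<open>DIM('a)\<close>:
  the exchange inequality feeds the averaging argument, and the higher power enters through ball
  volumes. As \<open>H\<close> is chosen without reference to \<open>t\<close>, one tour serves all
  \<open>t\<close>.\<close>

lemma S_minimal_squares_le:
  fixes X :: "'a::euclidean_space set" and t :: nat
  assumes min: "\<And>H'. hamiltonian_cycle X H' \<Longrightarrow> S 2 H \<le> S 2 H'"
    and H: "hamiltonian_cycle X H" and X: "X \<subseteq> cball c R" and "0 \<le> R" and "1 \<le> t"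
  shows "S DIM('a) H \<le> 2 * (2 * real t + 1) * (sqrt (1 + 1 / real t) * (2 * R)) ^ DIM('a)"
proof -
  define a b where "a i = H ! i" and "b i = H ! (Suc i mod length H)" for i
  define s where "s = sqrt (real t / (real t + 1))"
  define r where "r i = s * norm (a i - b i) / 2" for i
  define A where "A i = ball (midpoint (a i) (b i)) (r i) \<inter> cball c R" for i
  define n where "n = DIM('a)"
  define v where "v = unit_ball_vol (real n)"
  have s: "0 < s" "s\<^sup>2 \<le> 1" "s * sqrt (1 + 1 / real t) = 1"
  proof -
    have eq: "real t / (real t + 1) * (1 + 1 / real t) = 1"
      using \<open>1 \<le> t\<close> by (auto simp: field_simps add_nonneg_eq_0_iff)
    show "s * sqrt (1 + 1 / real t) = 1"
      unfolding s_def real_sqrt_mult [symmetric] eq by simp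
  qed (use \<open>1 \<le> t\<close> in \<open>auto simp: s_def\<close>)
  have "v > 0" by (simp add: v_def)
  have r0: "0 \<le> r i" for i using s by (simp add: r_def)
  have half: "v * r i ^ n \<le> 2 * measure lebesgue (A i)" if "i < length H" for i
  proof -
    have "a i \<in> X" "b i \<in> X"
      using that H by (auto simp: a_def b_def hamiltonian_cycle_def intro!: nth_mem mod_less_divisor)
    then have "dist c (a i) \<le> R" "dist c (b i) \<le> R" using X by auto
    then have "(dist c (a i))\<^sup>2 \<le> R\<^sup>2" "(dist c (b i))\<^sup>2 \<le> R\<^sup>2" by (simp_all add: power_mono)
    \<comment> \<open>Median formula: the midpoint of a chord is closer to \<open>c\<close> by just
      enough to absorb \<open>(r i)^2\<close>, since \<open>r i\<close> is at most half the edge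
      length.\<close>
    moreover have "4 * (dist c (midpoint (a i) (b i)))\<^sup>2 =
        2 * (dist c (a i))\<^sup>2 + 2 * (dist c (b i))\<^sup>2 - (norm (a i - b i))\<^sup>2"
      by (simp add: dist_norm midpoint_def power2_norm_eq_inner inner_diff inner_add
          inner_commute field_simps)
    moreover have "4 * (r i)\<^sup>2 \<le> (norm (a i - b i))\<^sup>2"
      using mult_right_mono [OF s(2), of "(norm (a i - b i))\<^sup>2"]
      by (simp add: r_def power_mult_distrib power_divide)
    ultimately have "(dist c (midpoint (a i) (b i)))\<^sup>2 + (r i)\<^sup>2 \<le> R\<^sup>2" by linarith
    from measure_ball_le_twice_inter_cball [OF this \<open>0 \<le> R\<close>] show ?thesis
      using r0 by (simp add: A_def v_def n_def content_ball)
  qed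
  have exch: "(norm (a i - b i))\<^sup>2 + (norm (a j - b j))\<^sup>2 \<le> (norm (a i - a j))\<^sup>2 + (norm (b i - b j))\<^sup>2"
    if "i < length H" "j < length H" "i \<noteq> j" for i j
    using that two_opt [OF min H, of i j] two_opt [OF min H, of j i]
    by (cases "i < j") (auto simp: a_def b_def norm_minus_commute add.commute)
  have mult: "real (card {i \<in> {..<length H}. y \<in> A i}) \<le> 2 * real t + 1" for y
  proof -
    have "real (card {i \<in> {..<length H}. y \<in> A i}) < 2 * (real t + 1)"
      using \<open>1 \<le> t\<close> exch
      by (intro card_balls_at_midpoints_le [where a = a and b = b and y = y])
        (auto simp: A_def r_def s_def)
    \<comment> \<open>The passage to naturals turns the strict bound \<open>2 * t + 2\<close> into
      \<open>2 * t + 1\<close>.\<close>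
    then have "real (card {i \<in> {..<length H}. y \<in> A i}) < real (2 * (t + 1))"
      by simp
    then have "card {i \<in> {..<length H}. y \<in> A i} \<le> 2 * t + 1"
      unfolding of_nat_less_iff by simp
    then have "real (card {i \<in> {..<length H}. y \<in> A i}) \<le> real (2 * t + 1)"
      unfolding of_nat_le_iff .
    then show ?thesis by simp
  qed
  have A_measurable: "A i \<in> lmeasurable" and A_subset: "A i \<subseteq> cball c R" for i
    by (auto simp: A_def intro: fmeasurable.Int)
  have "(v * (s / 2) ^ n) * S n H = (\<Sum>i<length H. v * r i ^ n)"
    by (simp add: S_def a_def b_def r_def sum_distrib_left power_mult_distrib power_divide mult.assoc)
  also have "\<dots> \<le> (\<Sum>i<length H. 2 * measure lebesgue (A i))"
    using half by (intro sum_mono) auto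
  also have "\<dots> \<le> 2 * ((2 * real t + 1) * measure lebesgue (cball c R))"
    unfolding sum_distrib_left [symmetric]
    by (intro mult_left_mono sum_measure_le_multiplicity mult A_subset A_measurable) simp_all
  also have "\<dots> = 2 * (2 * real t + 1) * v * R ^ n"
    using \<open>0 \<le> R\<close> by (simp add: content_cball v_def n_def)
  \<comment> \<open>Since \<open>s\<close> and \<open>sqrt (1 + 1 / t)\<close> are reciprocal, this
    extracts the factor \<open>(s / 2) ^ n\<close> that multiplies \<open>S n H\<close> on the left,
    ready to be cancelled.\<close>
  also have "R ^ n = ((s / 2) * (sqrt (1 + 1 / real t) * (2 * R))) ^ n"
    using s(3) by (simp flip: mult.assoc)
  finally have "(v * (s / 2) ^ n) * S n H \<le> (v * (s / 2) ^ n) *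
      (2 * (2 * real t + 1) * (sqrt (1 + 1 / real t) * (2 * R)) ^ n)"
    by (simp only: power_mult_distrib mult_ac)
  then show ?thesis
    using \<open>v > 0\<close> s(1) by (simp add: n_def)
qed

section \<open>The unit cube and the choice of \<open>t\<close>\<close>

lemma unit_cube_subset_cball:
  "cbox 0 1 \<subseteq> cball ((1 / 2) *\<^sub>R 1 :: real ^ 'n::finite) (sqrt (real CARD('n)) / 2)"
proof
  fix x :: "real ^ 'n" assume x: "x \<in> cbox 0 1"
  have "(\<Sum>i\<in>UNIV. (1 / 2 - x $ i)\<^sup>2) \<le> (\<Sum>i\<in>(UNIV :: 'n set). (1 / 2)\<^sup>2)"
  proof (rule sum_mono)
    fix i
    have "0 \<le> x $ i" "x $ i \<le> 1" using x by (auto simp: mem_box_cart)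
    then show "(1 / 2 - x $ i)\<^sup>2 \<le> (1 / 2)\<^sup>2" by (intro abs_le_square_iff [THEN iffD1]) (auto simp: abs_if)
  qed
  then have "sqrt (\<Sum>i\<in>UNIV. (1 / 2 - x $ i)\<^sup>2) \<le> sqrt (real CARD('n) / 4)"
    by (simp add: power2_eq_square)
  then show "x \<in> cball ((1 / 2) *\<^sub>R 1) (sqrt (real CARD('n)) / 2)"
    by (simp add: dist_vec_def L2_set_def dist_real_def real_sqrt_divide)
qed

lemma bound_with_optimal_parameter_le:
  assumes "1 \<le> k"
  shows "\<exists>t\<ge>1. (2 * real t + 1) * (1 + 1 / real t) powr (real k / 2) \<le> exp 1 * (real k + 1)"
proof -
  have le_exp: "(1 + x) powr p \<le> exp (x * p)" if "0 \<le> x" "0 \<le> p" for x p :: real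
    using that powr_mono2 [of p "1 + x" "exp x"] exp_ge_add_one_self [of x]
    by (simp add: powr_def mult.commute)
  show ?thesis
  proof (cases "even k")
    case True
    then obtain t where t: "k = 2 * t" by (elim evenE)
    \<comment> \<open>Here the first factor is exactly \<open>k + 1\<close>, and
      \<open>(1 + 1 / t)\<close> to the power \<open>t\<close> is at most
      \<open>exp 1\<close>.\<close>
    then show ?thesis
      using assms le_exp [of "1 / real t" "real t"]
      by (intro exI [of _ t]) (auto simp: mult.commute [of _ "2 * real t + 1"] add.commute)
  next
    case False
    then obtain u where u: "k = 2 * u + 1" by (elim oddE)
    define t where "t = real u + 1"
    \<comment> \<open>Now \<open>k = 2 * t - 1\<close>, so the target factor \<open>k + 1\<close> is
      \<open>2 * t\<close>. The excess \<open>1 + 1 / (2 * t)\<close> is at most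
      \<open>exp (1 / (2 * t))\<close>, which supplies exactly the exponent missing from
      \<open>k / (2 * t)\<close> to reach 1.\<close>
    have "(2 * t + 1) = (1 + 1 / (2 * t)) * (2 * t)"
      by (simp add: t_def field_simps)
    also have "\<dots> \<le> exp (1 / (2 * t)) * (2 * t)"
      by (intro mult_right_mono exp_ge_add_one_self) (simp add: t_def)
    finally have "(2 * t + 1) * (1 + 1 / t) powr (real k / 2)
        \<le> (exp (1 / (2 * t)) * (2 * t)) * exp (1 / t * (real k / 2))"
      by (intro mult_mono le_exp) (auto simp: t_def)
    also have "\<dots> = exp (1 / (2 * t) + 1 / t * (real k / 2)) * (2 * t)"
      by (simp add: exp_add)
    also have "1 / (2 * t) + 1 / t * (real k / 2) = 1"
      by (simp add: t_def u field_simps)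
    finally show ?thesis
      by (intro exI [of _ "Suc u"]) (auto simp: t_def u add.commute)
  qed
qed

lemma ex_hamiltonian_cycle_S_le:
  fixes X :: "(real ^ 'n::finite) set"
  assumes "finite X" "X \<subseteq> cbox 0 1" and k: "k = CARD('n)"
  obtains H where "hamiltonian_cycle X H"
    and "\<And>t::nat. t \<ge> 1 \<Longrightarrow> S k H \<le> 2 * (2 * real t + 1) * (1 + 1 / real t) powr (real k / 2)
                          * real k powr (real k / 2)"
    and "S k H \<le> 2 * exp 1 * (real k + 1) * real k powr (real k / 2)"
proof -
  obtain H where H: "hamiltonian_cycle X H"
    and min: "\<And>H'. hamiltonian_cycle X H' \<Longrightarrow> S 2 H \<le> S 2 H'"
    using ex_is_arg_min_if_finite [OF finite_hamiltonian_cycles hamiltonian_cycles_nonempty [OF assms(1)], of "S 2"]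
    by (auto simp: is_arg_min_linorder)
  have sqrt_power: "sqrt x ^ k = x powr (real k / 2)" if "0 < x" for x
    using that by (simp add: powr_half_sqrt [symmetric] powr_realpow [symmetric] powr_powr)
  have "k \<ge> 1" by (simp add: k Suc_leI)
  have bound: "S k H \<le> 2 * (2 * real t + 1) * (1 + 1 / real t) powr (real k / 2)
      * real k powr (real k / 2)" if "t \<ge> 1" for t :: nat
  proof -
    \<comment> \<open>The radius is half the diagonal of the cube, so \<open>2 * R\<close> becomes
      \<open>sqrt k\<close>, whose \<open>k\<close>-th power is the last factor of the
      bound.\<close>
    have "S k H \<le> 2 * (2 * real t + 1) * (sqrt (1 + 1 / real t) * (2 * (sqrt (real k) / 2))) ^ k"
      using S_minimal_squares_le [OF min H subset_trans [OF assms(2) unit_cube_subset_cball] _ that]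
      by (simp add: k)
    then show ?thesis
      using \<open>k \<ge> 1\<close> by (simp add: power_mult_distrib sqrt_power add_pos_nonneg mult.assoc)
  qed
  obtain t :: nat where t: "t \<ge> 1"
    "(2 * real t + 1) * (1 + 1 / real t) powr (real k / 2) \<le> exp 1 * (real k + 1)"
    using bound_with_optimal_parameter_le [OF \<open>k \<ge> 1\<close>] by blast
  have "S k H \<le> 2 * exp 1 * (real k + 1) * real k powr (real k / 2)"
  proof -
    have "S k H \<le> (2 * real t + 1) * (1 + 1 / real t) powr (real k / 2)
        * (2 * real k powr (real k / 2))"
      using bound [OF t(1)] by (simp only: mult_ac)
    also have "\<dots> \<le> exp 1 * (real k + 1) * (2 * real k powr (real k / 2))"
      by (intro mult_right_mono t) simp
    finally show ?thesis by (simp only: mult_ac)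
  qed
  with H bound show ?thesis using that by blast
qed

theorem theorem1p9:
  fixes k :: nat
  assumes "k = CARD('n::finite)"
  shows "(\<forall>X :: (real ^ 'n) set. finite X \<and> X \<noteq> {} \<and> X \<subseteq> cbox 0 1 \<longrightarrow>
           (\<exists>H. hamiltonian_cycle X H \<and>
             (\<forall>t::nat. t \<ge> 1 \<longrightarrow>
                S k H \<le> 2 * (2 * real t + 1) * (1 + 1 / real t) powr (real k / 2)
                          * real k powr (real k / 2)) \<and>
             S k H \<le> 2 * exp 1 * (real k + 1) * real k powr (real k / 2)))
       \<and> S_HC_sup TYPE('n) \<le> ereal (2 * exp 1 * (real k + 1) * real k powr (real k / 2))"
proof
  show "\<forall>X :: (real ^ 'n) set. finite X \<and> X \<noteq> {} \<and> X \<subseteq> cbox 0 1 \<longrightarrow>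
           (\<exists>H. hamiltonian_cycle X H \<and>
             (\<forall>t::nat. t \<ge> 1 \<longrightarrow>
                S k H \<le> 2 * (2 * real t + 1) * (1 + 1 / real t) powr (real k / 2)
                          * real k powr (real k / 2)) \<and>
             S k H \<le> 2 * exp 1 * (real k + 1) * real k powr (real k / 2))"
    using ex_hamiltonian_cycle_S_le [OF _ _ assms] by metis
  show "S_HC_sup TYPE('n) \<le> ereal (2 * exp 1 * (real k + 1) * real k powr (real k / 2))"
    unfolding S_HC_sup_def
  proof (rule SUP_least)
    fix X :: "(real ^ 'n) set"
    assume "X \<in> {X. finite X \<and> X \<noteq> {} \<and> X \<subseteq> cbox 0 1}"
    then have "finite X" "X \<subseteq> cbox 0 1" by auto
    from ex_hamiltonian_cycle_S_le [OF this assms] obtain H where H: "hamiltonian_cycle X H"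
      and le: "S k H \<le> 2 * exp 1 * (real k + 1) * real k powr (real k / 2)" .
    have "S_HC k X \<le> S k H"
      unfolding S_HC_def using H by (intro Min_le) (auto simp: finite_hamiltonian_cycles)
    with le show "ereal (S_HC CARD('n) X)
        \<le> ereal (2 * exp 1 * (real k + 1) * real k powr (real k / 2))"
      using assms by simp
  qed
qed

end
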